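(* Let $k\ge\ell\ge\ell'\ge t\ge1$ be integers, let $\mathcal{F}\subseteq\{F\subseteq[k]:|F|\le\ell\}$ and $\mathcal{G}\subseteq\{G\subseteq[k]:|G|\le\ell'\}$ be non-empty cross $t$-intersecting families, and for $i\in[2]$ let $\omega_i:[0,k]\to\mathbb{R}_{\ge0}$ be non-increasing functions. Then $$\omega_1(\mathcal{F})+\omega_2(\mathcal{G})\le\max\Big\{\max_{a\in[t,\ell']}\{\omega_1(\mathcal{K}_k(a,\ell,t))+\omega_2(\mathcal{S}_k(a,\ell'))\},\ \max_{a\in[t,\ell]}\{\omega_1(\mathcal{S}_k(a,\ell))+\omega_2(\mathcal{K}_k(a,\ell',t))\}\Big\},$$ where $\mathcal{K}_k(a,s,t)=\{K\subseteq[k]:|K|\le s,\ |K\cap[a]|\ge t\}$ and $\mathcal{S}_k(a,s)=\{S\subseteq[k]:|S|\le s,\ [a]\subseteq S\}$.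
   Context: $[p,q]=\{p,\dots,q\}$, $[q]=[1,q]$. Families are cross $t$-intersecting if $|F\cap G|\ge t$ for all $F\in\mathcal{F},G\in\mathcal{G}$. For $\omega:[0,k]\to\mathbb{R}_{\ge0}$, $\omega(F)=\omega(|F|)$ and $\omega(\mathcal{F})=\sum_{F\in\mathcal{F}}\omega(F)$; non-increasing means $\omega(i)\ge\omega(j)$ whenever $i\le j$. *)

theory Defs
  imports Main "HOL-Library.Disjoint_Sets" Complex_Main
begin

definition cross_t_intersecting :: "nat \<Rightarrow> 'a set set \<Rightarrow> 'a set set \<Rightarrow> bool" where
  "cross_t_intersecting t \<F> \<G> \<longleftrightarrow> (\<forall>F\<in>\<F>. \<forall>G\<in>\<G>. card (F \<inter> G) \<ge> t)"

definition wfam :: "(nat \<Rightarrow> real) \<Rightarrow> nat set set \<Rightarrow> real" where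
  "wfam \<omega> \<F> = (\<Sum>F\<in>\<F>. \<omega> (card F))"

definition Kfam :: "nat \<Rightarrow> nat \<Rightarrow> nat \<Rightarrow> nat \<Rightarrow> nat set set" where
  "Kfam k a s t = {K. K \<subseteq> {1..k} \<and> card K \<le> s \<and> card (K \<inter> {1..a}) \<ge> t}"

definition Sfam :: "nat \<Rightarrow> nat \<Rightarrow> nat \<Rightarrow> nat set set" where
  "Sfam k a s = {S. S \<subseteq> {1..k} \<and> card S \<le> s \<and> {1..a} \<subseteq> S}"

end

theory Submission
  imports Defs
begin

text \<open>
  Every set system on \<open>U\<close> can be pushed down to \<open>U - {x}\<close> by replacing a weight \<open>A\<close> with
  \<open>A i + A (i + 1)\<close>. A cross \<open>t\<close>-intersecting pair \<open>(\<F>, \<G>)\<close> can be pushed down in two ways: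
  delete \<open>x\<close> from all members of \<open>\<F>\<close> and keep only the members of \<open>\<G>\<close> avoiding \<open>x\<close>, or vice
  versa. Both results are cross \<open>t\<close>-intersecting, and because the weights are non-increasing their
  total weights average to at least the original one. So induction applies unless for every \<open>x\<close> one of
  the families has \<open>x\<close> in all its members. In that case either \<open>\<Inter>\<G> = U\<close> or \<open>\<Inter>\<F> = U\<close>, which
  is an extremal configuration, or one shift \<open>y \<rightarrow> x\<close> with \<open>x \<in> \<Inter>\<G> - \<Inter>\<F>\<close> and
  \<open>y \<in> \<Inter>\<F> - \<Inter>\<G>\<close> frees the element \<open>y\<close>.
\<close>

section \<open>Weights of families, and how they change when one element is deleted\<close>

lemma wfam_mono:
  assumes "\<F> \<subseteq> \<G>" "finite \<G>" "\<And>i. 0 \<le> A i"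
  shows "wfam A \<F> \<le> wfam A \<G>"
  unfolding wfam_def by (intro sum_mono2) (use assms in auto)

lemma wfam_image:
  assumes "inj_on f \<F>" "\<And>F. F \<in> \<F> \<Longrightarrow> card (f F) = card F"
  shows "wfam A (f ` \<F>) = wfam A \<F>"
  unfolding wfam_def by (subst sum.reindex) (use assms in auto)

lemma wfam_insert_image:
  assumes "\<And>F. F \<in> \<F> \<Longrightarrow> finite F \<and> x \<notin> F"
  shows "wfam A (insert x ` \<F>) = wfam (\<lambda>i. A (Suc i)) \<F>"
proof -
  have "inj_on (insert x) \<F>"
    using assms by (intro inj_onI) (metis insert_ident)
  then show ?thesis
    unfolding wfam_def by (subst sum.reindex) (use assms in \<open>auto intro!: sum.cong\<close>)
qed

lemma wfam_add: "wfam (\<lambda>i. A i + B i) \<F> = wfam A \<F> + wfam B \<F>"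
  by (simp add: wfam_def sum.distrib)

lemma wfam_union_disjoint:
  assumes "finite \<F>" "finite \<G>" "\<F> \<inter> \<G> = {}"
  shows "wfam A (\<F> \<union> \<G>) = wfam A \<F> + wfam A \<G>"
  unfolding wfam_def using assms by (rule sum.union_disjoint)

lemma wfam_split_element:
  assumes "finite U"
  shows "wfam A {F. F \<subseteq> U \<and> R F} =
    wfam A {F. F \<subseteq> U - {x} \<and> R F} + wfam A {F. F \<subseteq> U \<and> x \<in> F \<and> R F}"
proof -
  have "{F. F \<subseteq> U \<and> R F} = {F. F \<subseteq> U - {x} \<and> R F} \<union> {F. F \<subseteq> U \<and> x \<in> F \<and> R F}"
    by auto
  then show ?thesis
    using assms by (auto intro!: wfam_union_disjoint)
qed

text \<open>If \<open>R\<close> ignores \<open>x\<close>, the sets satisfying \<open>R\<close> come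
  in pairs \<open>F\<close>, \<open>insert x F\<close> with \<open>x\<close> not in
  \<open>F\<close>, and each pair contributes \<open>A i + A (Suc i)\<close> for
  \<open>i = card F\<close>. Thus bounds on extremal configurations pass to the smaller ground
  set.\<close>

lemma wfam_pushdown:
  assumes "finite U" "x \<in> U" "\<And>F. R (insert x F) = R F"
  shows "wfam (\<lambda>i. A i + A (Suc i)) {F. F \<subseteq> U - {x} \<and> R F} = wfam A {F. F \<subseteq> U \<and> R F}"
proof -
  have "F \<in> insert x ` {F. F \<subseteq> U - {x} \<and> R F}" if "F \<subseteq> U" "x \<in> F" "R F" for F
  proof
    show "F = insert x (F - {x})" using that by auto
    show "F - {x} \<in> {F. F \<subseteq> U - {x} \<and> R F}"
      using that assms(3)[of "F - {x}"] by (auto simp: insert_absorb)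
  qed
  then have "{F. F \<subseteq> U \<and> x \<in> F \<and> R F} = insert x ` {F. F \<subseteq> U - {x} \<and> R F}"
    using assms by auto
  moreover have "wfam A (insert x ` {F. F \<subseteq> U - {x} \<and> R F}) =
      wfam (\<lambda>i. A (Suc i)) {F. F \<subseteq> U - {x} \<and> R F}"
    using assms(1) by (intro wfam_insert_image) (auto intro: finite_subset)
  ultimately show ?thesis
    using wfam_split_element[OF assms(1), of A R x] by (simp add: wfam_add)
qed

text \<open>Let \<open>D\<close> be the members avoiding \<open>x\<close> and \<open>L\<close> the
  link of \<open>x\<close>; the projection is \<open>D \<union> L\<close>, where sets in both are
  merged. Such a set is counted again in \<open>D\<close>, so nothing is lost. A set in
  \<open>L - D\<close> is counted once, with weight \<open>A i + A (Suc i)\<close>, which is at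
  least \<open>2 * A (Suc i)\<close> by monotonicity.\<close>

lemma wfam_average_pushdown:
  assumes U: "finite U" and \<F>: "\<F> \<subseteq> Pow U"
    and A: "\<And>i. 0 \<le> A i" "\<And>i. A (Suc i) \<le> A i"
  shows "2 * wfam A \<F> \<le> wfam (\<lambda>i. A i + A (Suc i)) {F \<in> \<F>. x \<notin> F}
    + wfam (\<lambda>i. A i + A (Suc i)) ((\<lambda>F. F - {x}) ` \<F>)"
proof -
  define D where "D = {F \<in> \<F>. x \<notin> F}"
  define L where "L = (\<lambda>F. F - {x}) ` {F \<in> \<F>. x \<in> F}"
  let ?A' = "\<lambda>i. A (Suc i)"
  have fin\<F>: "finite \<F>" using U \<F> by (meson finite_Pow_iff finite_subset)
  then have fin: "finite D" "finite L" by (auto simp: D_def L_def)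
  have "(\<lambda>F. F - {x}) ` D = D"
    by (force simp: D_def)
  moreover have "\<F> = D \<union> {F \<in> \<F>. x \<in> F}" by (auto simp: D_def)
  ultimately have proj: "(\<lambda>F. F - {x}) ` \<F> = D \<union> L"
    unfolding L_def using image_Un[of "\<lambda>F. F - {x}" D "{F \<in> \<F>. x \<in> F}"] by argo
  have "insert x ` L = (\<lambda>F. F) ` {F \<in> \<F>. x \<in> F}"
    unfolding L_def image_image by (rule image_cong) auto
  then have "insert x ` L = {F \<in> \<F>. x \<in> F}" by simp
  then have "\<F> = D \<union> insert x ` L" by (auto simp: D_def)
  moreover have "D \<inter> insert x ` L = {}" by (auto simp: D_def)
  ultimately have "wfam A \<F> = wfam A D + wfam A (insert x ` L)"
    using fin wfam_union_disjoint by (metis finite_imageI)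
  moreover have "wfam A (insert x ` L) = wfam ?A' L"
    using U \<F> by (intro wfam_insert_image) (auto simp: L_def intro: finite_subset)
  ultimately have F: "wfam A \<F> = wfam A D + wfam ?A' L" by simp
  have split: "wfam B (D \<union> L) = wfam B D + wfam B (L - D)" for B
    using fin wfam_union_disjoint[of D "L - D"] by auto
  have "wfam ?A' L \<le> wfam ?A' (D \<union> L)"
    using fin A by (intro wfam_mono) auto
  moreover have "wfam ?A' (L - D) \<le> wfam A (L - D)"
    unfolding wfam_def by (intro sum_mono A)
  ultimately show ?thesis
    by (simp add: proj F wfam_add split flip: D_def)
qed

section \<open>Cross-intersection under pushdown and shift, and the induction on the ground
  set\<close>

lemma cross_t_intersecting_commute:
  "cross_t_intersecting t \<F> \<G> \<longleftrightarrow> cross_t_intersecting t \<G> \<F>"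
  unfolding cross_t_intersecting_def by (metis inf_commute)

lemma cross_t_intersecting_pushdown:
  assumes "cross_t_intersecting t \<F> \<G>"
  shows "cross_t_intersecting t ((\<lambda>F. F - {x}) ` \<F>) {G \<in> \<G>. x \<notin> G}"
  unfolding cross_t_intersecting_def
proof clarify
  fix F G assume "F \<in> \<F>" "G \<in> \<G>" "x \<notin> G"
  moreover from this have "(F - {x}) \<inter> G = F \<inter> G" by auto
  ultimately show "t \<le> card ((F - {x}) \<inter> G)"
    using assms by (simp add: cross_t_intersecting_def)
qed

text \<open>A moved member loses at most \<open>y\<close> from its intersection with
  \<open>G\<close>, and it gains \<open>x\<close>, which lies in every \<open>G\<close>.\<close>

lemma cross_t_intersecting_shift:
  assumes "finite U" "\<F> \<subseteq> Pow U" "cross_t_intersecting t \<F> \<G>"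
    and "\<And>G. G \<in> \<G> \<Longrightarrow> x \<in> G"
  shows "cross_t_intersecting t ((\<lambda>F. if x \<in> F then F else insert x (F - {y})) ` \<F>) \<G>"
  unfolding cross_t_intersecting_def
proof clarify
  fix F G assume F: "F \<in> \<F>" and G: "G \<in> \<G>"
  have t: "t \<le> card (F \<inter> G)"
    using assms F G by (simp add: cross_t_intersecting_def)
  have fin: "finite (F \<inter> G)" using assms F by (auto intro: finite_subset)
  show "t \<le> card ((if x \<in> F then F else insert x (F - {y})) \<inter> G)"
  proof (cases "x \<in> F")
    case False
    then have "insert x (F - {y}) \<inter> G = insert x (F \<inter> G - {y})" "x \<notin> F \<inter> G - {y}"
      using assms(4)[OF G] by auto
    then have "card (insert x (F - {y}) \<inter> G) = Suc (card (F \<inter> G - {y}))"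
      using fin by simp
    moreover have "card (F \<inter> G) \<le> Suc (card (F \<inter> G - {y}))"
      using diff_card_le_card_Diff[of "{y}" "F \<inter> G"] by simp
    ultimately show ?thesis using t False by simp
  qed (use t in simp)
qed

text \<open>The induction may delete any element and changes the weights, so \<open>P\<close> ranges
  over arbitrary subsets and \<open>A\<close>, \<open>B\<close> stay general. The extremal families
  carry no size limit: a limit would break the pairing of \<open>F\<close> with
  \<open>insert x F\<close>. Sizes enter only through the bounds on \<open>card P\<close>.\<close>

theorem cross_t_intersecting_wfam_le:
  assumes "finite U" "\<F> \<subseteq> Pow U" "\<G> \<subseteq> Pow U" "\<F> \<noteq> {}" "\<G> \<noteq> {}"
    and "cross_t_intersecting t \<F> \<G>"
    and "\<And>F. F \<in> \<F> \<Longrightarrow> card F \<le> l" "\<And>G. G \<in> \<G> \<Longrightarrow> card G \<le> l'"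
    and "\<And>i. 0 \<le> A i" "\<And>i. A (Suc i) \<le> A i" "\<And>i. 0 \<le> B i" "\<And>i. B (Suc i) \<le> B i"
    and "\<And>P. P \<subseteq> U \<Longrightarrow> t \<le> card P \<Longrightarrow> card P \<le> l' \<Longrightarrow>
      wfam A {K. K \<subseteq> U \<and> t \<le> card (K \<inter> P)} + wfam B {S. S \<subseteq> U \<and> P \<subseteq> S} \<le> M"
    and "\<And>P. P \<subseteq> U \<Longrightarrow> t \<le> card P \<Longrightarrow> card P \<le> l \<Longrightarrow>
      wfam A {S. S \<subseteq> U \<and> P \<subseteq> S} + wfam B {K. K \<subseteq> U \<and> t \<le> card (K \<inter> P)} \<le> M"
  shows "wfam A \<F> + wfam B \<G> \<le> M"
  using assms
proof (induction U arbitrary: \<F> \<G> A B rule: finite_psubset_induct)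
  case (psubset U)
  note U = \<open>finite U\<close> and A = psubset.prems(8,9) and B = psubset.prems(10,11)
    and M1 = psubset.prems(12) and M2 = psubset.prems(13)
  have finPow: "finite {S. S \<subseteq> U \<and> R S}" for R using U by simp
  \<comment> \<open>The first family is kept variable because this is applied both to \<F> and to a
    shifted copy of it. The witnesses avoiding \<open>x\<close> keep the restricted families in both
    pushdowns non-empty.\<close>
  have free: "wfam A \<F>' + wfam B \<G> \<le> M"
    if \<F>': "\<F>' \<subseteq> Pow U" "cross_t_intersecting t \<F>' \<G>" "\<And>F. F \<in> \<F>' \<Longrightarrow> card F \<le> l"
      and x: "x \<in> U" "F \<in> \<F>'" "x \<notin> F" "G \<in> \<G>" "x \<notin> G" for \<F>' x F G
  proof -
    let ?del = "\<lambda>\<H>. {H \<in> \<H>. x \<notin> H}" and ?proj = "(`) (\<lambda>H. H - {x})"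
    let ?A = "\<lambda>i. A i + A (Suc i)" and ?B = "\<lambda>i. B i + B (Suc i)"
    have K: "card (insert x K \<inter> P) = card (K \<inter> P)" if "P \<subseteq> U - {x}" for K P
      using that by (metis Diff_iff Int_insert_left insertCI subsetD)
    have S: "(P \<subseteq> insert x S) = (P \<subseteq> S)" if "P \<subseteq> U - {x}" for S P
      using that by blast
    \<comment> \<open>As \<open>P\<close> avoids \<open>x\<close>, membership in either extremal
      family does not depend on \<open>x\<close>, so the pushed-down configuration has the same
      total weight as the one on \<open>U\<close>.\<close>
    have Mx: "wfam ?A {K. K \<subseteq> U - {x} \<and> t \<le> card (K \<inter> P)} + wfam ?B {S. S \<subseteq> U - {x} \<and> P \<subseteq> S} \<le> M"
      if "P \<subseteq> U - {x}" "t \<le> card P" "card P \<le> l'" for P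
      using M1[of P] that U x(1) by (subst (1 2) wfam_pushdown) (auto simp: K S)
    have My: "wfam ?A {S. S \<subseteq> U - {x} \<and> P \<subseteq> S} + wfam ?B {K. K \<subseteq> U - {x} \<and> t \<le> card (K \<inter> P)} \<le> M"
      if "P \<subseteq> U - {x}" "t \<le> card P" "card P \<le> l" for P
      using M2[of P] that U x(1) by (subst (1 2) wfam_pushdown) (auto simp: K S)
    have small: "card (H - {x}) \<le> n" if "card H \<le> n" for H n
      using that by (meson card_Diff1_le le_trans)
    have wts: "0 \<le> ?A i" "?A (Suc i) \<le> ?A i" "0 \<le> ?B i" "?B (Suc i) \<le> ?B i" for i
      using A B by (simp_all add: add_mono)
    have cross1: "cross_t_intersecting t (?proj \<F>') (?del \<G>)"
      using \<F>'(2) by (rule cross_t_intersecting_pushdown)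
    have cross2: "cross_t_intersecting t (?del \<F>') (?proj \<G>)"
      using \<F>'(2) cross_t_intersecting_pushdown cross_t_intersecting_commute by metis
    have Ux: "U - {x} \<subset> U" using x by auto
    have 1: "wfam ?A (?proj \<F>') + wfam ?B (?del \<G>) \<le> M"
      by (rule psubset.IH[OF Ux _ _ _ _ cross1 _ _ wts Mx My])
        (use \<F>' psubset.prems(2,7) x in \<open>auto intro: small\<close>)
    have 2: "wfam ?A (?del \<F>') + wfam ?B (?proj \<G>) \<le> M"
      by (rule psubset.IH[OF Ux _ _ _ _ cross2 _ _ wts Mx My])
        (use \<F>' psubset.prems(2,7) x in \<open>auto intro: small\<close>)
    \<comment> \<open>The four terms of the two averaging bounds regroup into the left sides of
      \<open>1\<close> and \<open>2\<close>, so twice the original weight is at most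
      \<open>2 * M\<close>.\<close>
    show ?thesis
      using 1 2 wfam_average_pushdown[OF U \<F>'(1), where A = A and x = x, OF A]
        wfam_average_pushdown[OF U psubset.prems(2), where A = B and x = x, OF B] by linarith
  qed
  show ?case
  proof (cases "\<exists>x\<in>U. (\<exists>F\<in>\<F>. x \<notin> F) \<and> (\<exists>G\<in>\<G>. x \<notin> G)")
    case True
    then show ?thesis using psubset.prems(1,5,6) free by blast
  next
    case False
    consider "\<forall>x\<in>U. \<forall>G\<in>\<G>. x \<in> G" | "\<forall>y\<in>U. \<forall>F\<in>\<F>. y \<in> F"
      | "\<not> (\<forall>x\<in>U. \<forall>G\<in>\<G>. x \<in> G)" "\<not> (\<forall>y\<in>U. \<forall>F\<in>\<F>. y \<in> F)"
      by blast
    then show ?thesis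
    proof cases
      case 1
      have "G = U" if "G \<in> \<G>" for G using 1 psubset.prems(2) that by auto
      then have \<G>: "\<G> = {U}" using psubset.prems(4) by auto
      have tF: "t \<le> card (F \<inter> U)" if "F \<in> \<F>" for F
        using psubset.prems(5) that by (simp add: \<G> cross_t_intersecting_def)
      then have "t \<le> card U"
        using psubset.prems(3) U by (meson Int_lower2 all_not_in_conv card_mono le_trans)
      moreover have "wfam A \<F> \<le> wfam A {K. K \<subseteq> U \<and> t \<le> card (K \<inter> U)}"
        using psubset.prems(1) tF by (intro wfam_mono finPow A) auto
      moreover have "wfam B \<G> \<le> wfam B {S. S \<subseteq> U \<and> U \<subseteq> S}"
        by (intro wfam_mono finPow B) (auto simp: \<G>)
      \<comment> \<open>The configuration is the one with \<open>P = U\<close>; the bound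
        \<open>card U \<le> l'\<close> holds because \<open>U\<close> is itself a member of
        \<G>.\<close>
      ultimately show ?thesis
        using M1[of U] psubset.prems(7) \<G> by simp
    next
      case 2
      have "F = U" if "F \<in> \<F>" for F using 2 psubset.prems(1) that by auto
      then have \<F>: "\<F> = {U}" using psubset.prems(3) by auto
      have tG: "t \<le> card (G \<inter> U)" if "G \<in> \<G>" for G
        using psubset.prems(5) that by (simp add: \<F> cross_t_intersecting_def Int_commute)
      then have "t \<le> card U"
        using psubset.prems(4) U by (meson Int_lower2 all_not_in_conv card_mono le_trans)
      moreover have "wfam B \<G> \<le> wfam B {K. K \<subseteq> U \<and> t \<le> card (K \<inter> U)}"
        using psubset.prems(2) tG by (intro wfam_mono finPow B) auto
      moreover have "wfam A \<F> \<le> wfam A {S. S \<subseteq> U \<and> U \<subseteq> S}"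
        by (intro wfam_mono finPow A) (auto simp: \<F>)
      ultimately show ?thesis
        using M2[of U] psubset.prems(6) \<F> by simp
    next
      case 3
      then obtain x y F G
        where xy_free: "x \<in> U" "F \<in> \<F>" "x \<notin> F" "y \<in> U" "G \<in> \<G>" "y \<notin> G"
        by blast
      \<comment> \<open>No element is missed by members of both families, so a miss in one family
        puts the element into every member of the other.\<close>
      have y: "y \<in> H" if "H \<in> \<F>" for H using False xy_free that by blast
      have x: "x \<in> H" if "H \<in> \<G>" for H using False xy_free that by blast
      let ?sh = "\<lambda>F. if x \<in> F then F else insert x (F - {y})"
      have xy: "x \<noteq> y" using xy_free y by blast
      have cardsh: "card (?sh H) = card H" if "H \<in> \<F>" for H
      proof -
        have "finite H" using psubset.prems(1) that U by (auto intro: finite_subset)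
        then show ?thesis using card.remove[of H y] y[OF that] by simp
      qed
      have "inj_on ?sh \<F>"
      proof (rule inj_onI)
        fix H H' assume H: "H \<in> \<F>" "H' \<in> \<F>" and eq: "?sh H = ?sh H'"
        \<comment> \<open>All members of \<F> contain \<open>y\<close>, so an image lacks
          \<open>y\<close> exactly when its original was moved; hence the shift can be
          undone.\<close>
        have "y \<in> ?sh H \<longleftrightarrow> x \<in> H" "y \<in> ?sh H' \<longleftrightarrow> x \<in> H'"
          using y H xy by auto
        with eq have "x \<in> H \<longleftrightarrow> x \<in> H'" by simp
        with eq show "H = H'"
          using y[OF H(1)] y[OF H(2)] by (metis DiffD1 insert_Diff insert_ident)
      qed
      then have "wfam A \<F> = wfam A (?sh ` \<F>)"
        using cardsh by (intro wfam_image[symmetric])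
      \<comment> \<open>After the shift, \<open>y\<close> is missed by both \<open>?sh F\<close> and
        \<open>G\<close>, so \<open>free\<close> applies with \<open>y\<close> as the element to
        delete.\<close>
      moreover have "wfam A (?sh ` \<F>) + wfam B \<G> \<le> M"
      proof (rule free)
        show "?sh ` \<F> \<subseteq> Pow U" using psubset.prems(1) xy_free(1) by auto
        show "cross_t_intersecting t (?sh ` \<F>) \<G>"
          using U psubset.prems(1,5) x by (rule cross_t_intersecting_shift)
        show "card H \<le> l" if H: "H \<in> ?sh ` \<F>" for H
        proof -
          obtain H' where H': "H' \<in> \<F>" "H = ?sh H'" using H by auto
          show ?thesis unfolding H'(2) cardsh[OF H'(1)] using H'(1) by (rule psubset.prems(6))
        qed
        show "?sh F \<in> ?sh ` \<F>" using xy_free(2) by (rule imageI)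
        show "y \<notin> ?sh F" using xy_free(3) xy by simp
      qed (use xy_free in auto)
      ultimately show ?thesis by simp
    qed
  qed
qed

section \<open>From arbitrary sets \<open>P\<close> to initial segments, and from size limits to
  truncated weights\<close>

lemma wfam_permute:
  assumes "bij_betw f U U" "\<And>H. H \<subseteq> U \<Longrightarrow> R (f ` H) = R' H"
  shows "wfam A {H. H \<subseteq> U \<and> R H} = wfam A {H. H \<subseteq> U \<and> R' H}"
proof -
  have inj: "inj_on f U" and im: "f ` U = U"
    using assms(1) by (auto simp: bij_betw_def)
  have "{H. H \<subseteq> U \<and> R H} = (`) f ` {H. H \<subseteq> U \<and> R' H}"
  proof (intro equalityI subsetI)
    fix H assume H: "H \<in> {H. H \<subseteq> U \<and> R H}"
    then obtain H' where "H' \<subseteq> U" "H = f ` H'"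
      using im by (metis mem_Collect_eq subset_image_iff)
    then show "H \<in> (`) f ` {H. H \<subseteq> U \<and> R' H}" using H assms(2) by auto
  qed (use im assms(2) in auto)
  moreover have "wfam A ((`) f ` {H. H \<subseteq> U \<and> R' H}) = wfam A {H. H \<subseteq> U \<and> R' H}"
  proof (rule wfam_image)
    show "inj_on ((`) f) {H. H \<subseteq> U \<and> R' H}"
      by (rule inj_onI) (use inj inj_on_image_eq_iff in blast)
    show "card (f ` H) = card H" if "H \<in> {H. H \<subseteq> U \<and> R' H}" for H
      using that inj by (auto intro: card_image inj_on_subset)
  qed
  ultimately show ?thesis by simp
qed

text \<open>Glue a bijection from \<open>P\<close> onto the segment with one between the
  complements, which have equal size.\<close>

lemma ex_bij_betw_initial_segment:
  assumes "P \<subseteq> {1..k}"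
  obtains f where "bij_betw f {1..k} {1..k}" "f ` P = {1..card P}"
proof -
  have fin: "finite P" using assms finite_subset by blast
  have le: "card P \<le> k" using card_mono[OF _ assms] by simp
  have "card ({1..k} - P) = card ({1..k} - {1..card P})"
    using assms fin le by (simp add: card_Diff_subset)
  then obtain h where h: "bij_betw h ({1..k} - P) ({1..k} - {1..card P})"
    using finite_same_card_bij by (metis finite_Diff finite_atLeastAtMost)
  obtain g where g: "bij_betw g P {1..card P}"
    using fin finite_same_card_bij[of P "{1..card P}"] by auto
  let ?f = "\<lambda>x. if x \<in> P then g x else h x"
  have "bij_betw ?f P {1..card P}"
    using g by (subst bij_betw_cong[where g = g]) auto
  moreover have "bij_betw ?f ({1..k} - P) ({1..k} - {1..card P})"
    using h by (subst bij_betw_cong[where g = h]) auto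
  ultimately have "bij_betw ?f (P \<union> ({1..k} - P)) ({1..card P} \<union> ({1..k} - {1..card P}))"
    by (rule bij_betw_combine) auto
  moreover have "P \<union> ({1..k} - P) = {1..k}" "{1..card P} \<union> ({1..k} - {1..card P}) = {1..k}"
    using assms le by auto
  ultimately have "bij_betw ?f {1..k} {1..k}" by simp
  moreover have "?f ` P = {1..card P}" using g by (auto simp: bij_betw_def)
  ultimately show ?thesis by (rule that)
qed

lemma wfam_cutoff:
  "finite \<F> \<Longrightarrow> wfam (\<lambda>i. if i \<le> s then \<omega> i else 0) \<F> = wfam \<omega> {F \<in> \<F>. card F \<le> s}"
  unfolding wfam_def by (rule sum.inter_filter[symmetric])

text \<open>Relabelling \<open>P\<close> as an initial segment preserves set sizes and intersection
  sizes with \<open>P\<close>, so the weight depends on \<open>P\<close> only through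
  \<open>card P\<close>. The truncated weight then supplies the size limit.\<close>

lemma wfam_cutoff_Kfam:
  assumes "P \<subseteq> {1..k}"
  shows "wfam (\<lambda>i. if i \<le> s then \<omega> i else 0) {K. K \<subseteq> {1..k} \<and> t \<le> card (K \<inter> P)} =
    wfam \<omega> (Kfam k (card P) s t)"
proof -
  obtain f where f: "bij_betw f {1..k} {1..k}" "f ` P = {1..card P}"
    using ex_bij_betw_initial_segment[OF assms] .
  have inj: "inj_on f {1..k}" using f(1) by (simp add: bij_betw_def)
  have "card (f ` H \<inter> {1..card P}) = card (H \<inter> P)" if "H \<subseteq> {1..k}" for H
  proof -
    have "f ` H \<inter> {1..card P} = f ` (H \<inter> P)"
      using inj_on_image_Int[OF inj that assms] f(2) by simp
    then show ?thesis
      using inj that by (auto intro: card_image inj_on_subset)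
  qed
  then have perm: "wfam A {K. K \<subseteq> {1..k} \<and> t \<le> card (K \<inter> {1..card P})} =
      wfam A {K. K \<subseteq> {1..k} \<and> t \<le> card (K \<inter> P)}" for A
    by (intro wfam_permute[OF f(1)]) simp
  then show ?thesis
    unfolding perm[symmetric] by (simp add: wfam_cutoff Kfam_def conj_ac)
qed

lemma wfam_cutoff_Sfam:
  assumes "P \<subseteq> {1..k}"
  shows "wfam (\<lambda>i. if i \<le> s then \<omega> i else 0) {S. S \<subseteq> {1..k} \<and> P \<subseteq> S} =
    wfam \<omega> (Sfam k (card P) s)"
proof -
  obtain f where f: "bij_betw f {1..k} {1..k}" "f ` P = {1..card P}"
    using ex_bij_betw_initial_segment[OF assms] .
  have inj: "inj_on f {1..k}" using f(1) by (simp add: bij_betw_def)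
  have "{1..card P} \<subseteq> f ` H \<longleftrightarrow> P \<subseteq> H" if "H \<subseteq> {1..k}" for H
    unfolding f(2)[symmetric] image_subset_iff
    using inj_on_image_mem_iff[OF inj _ that] assms by (auto simp: subset_iff)
  then have perm: "wfam A {S. S \<subseteq> {1..k} \<and> {1..card P} \<subseteq> S} = wfam A {S. S \<subseteq> {1..k} \<and> P \<subseteq> S}" for A
    by (intro wfam_permute[OF f(1)])
  then show ?thesis
    unfolding perm[symmetric] by (simp add: wfam_cutoff Sfam_def conj_ac)
qed

theorem theorem3p6:
  fixes k l l' t :: nat
    and \<F> \<G> :: "nat set set"
    and \<omega>1 \<omega>2 :: "nat \<Rightarrow> real"
  assumes "k \<ge> l" "l \<ge> l'" "l' \<ge> t" "t \<ge> 1"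
    and "\<F> \<subseteq> {F. F \<subseteq> {1..k} \<and> card F \<le> l}"
    and "\<G> \<subseteq> {G. G \<subseteq> {1..k} \<and> card G \<le> l'}"
    and "\<F> \<noteq> {}" "\<G> \<noteq> {}"
    and "cross_t_intersecting t \<F> \<G>"
    and "\<forall>i\<in>{0..k}. \<omega>1 i \<ge> 0" "\<forall>i\<in>{0..k}. \<omega>2 i \<ge> 0"
    and "\<forall>i\<in>{0..k}. \<forall>j\<in>{0..k}. i \<le> j \<longrightarrow> \<omega>1 j \<le> \<omega>1 i"
    and "\<forall>i\<in>{0..k}. \<forall>j\<in>{0..k}. i \<le> j \<longrightarrow> \<omega>2 j \<le> \<omega>2 i"
  shows "wfam \<omega>1 \<F> + wfam \<omega>2 \<G> \<le>
    max (Max ((\<lambda>a. wfam \<omega>1 (Kfam k a l t) + wfam \<omega>2 (Sfam k a l')) ` {t..l'}))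
        (Max ((\<lambda>a. wfam \<omega>1 (Sfam k a l) + wfam \<omega>2 (Kfam k a l' t)) ` {t..l}))"
proof -
  \<comment> \<open>Vanishing beyond \<open>l\<close> and \<open>l'\<close> encodes the size limits.
    As \<open>l' \<le> l \<le> k\<close>, it also extends non-negativity and monotonicity from
    \<open>{0..k}\<close> to all naturals; the drop to 0 at the cutoff is harmless for non-negative
    weights.\<close>
  let ?A = "\<lambda>i. if i \<le> l then \<omega>1 i else 0" and ?B = "\<lambda>i. if i \<le> l' then \<omega>2 i else 0"
  let ?M = "max (Max ((\<lambda>a. wfam \<omega>1 (Kfam k a l t) + wfam \<omega>2 (Sfam k a l')) ` {t..l'}))
        (Max ((\<lambda>a. wfam \<omega>1 (Sfam k a l) + wfam \<omega>2 (Kfam k a l' t)) ` {t..l}))"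
  have wts: "0 \<le> ?A i" "?A (Suc i) \<le> ?A i" "0 \<le> ?B i" "?B (Suc i) \<le> ?B i" for i
    using assms(1,2,10-13) by auto
  \<comment> \<open>The configuration of \<open>P\<close> is the entry \<open>a = card P\<close> of
    the first maximum.\<close>
  have M1: "wfam ?A {K. K \<subseteq> {1..k} \<and> t \<le> card (K \<inter> P)} +
      wfam ?B {S. S \<subseteq> {1..k} \<and> P \<subseteq> S} \<le> ?M"
    if P: "P \<subseteq> {1..k}" "t \<le> card P" "card P \<le> l'" for P
    unfolding wfam_cutoff_Kfam[OF P(1)] wfam_cutoff_Sfam[OF P(1)]
    using P by (intro max.coboundedI1 Max_ge) auto
  have M2: "wfam ?A {S. S \<subseteq> {1..k} \<and> P \<subseteq> S} +
      wfam ?B {K. K \<subseteq> {1..k} \<and> t \<le> card (K \<inter> P)} \<le> ?M"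
    if P: "P \<subseteq> {1..k}" "t \<le> card P" "card P \<le> l" for P
    unfolding wfam_cutoff_Kfam[OF P(1)] wfam_cutoff_Sfam[OF P(1)]
    using P by (intro max.coboundedI2 Max_ge) auto
  have "wfam ?A \<F> + wfam ?B \<G> \<le> ?M"
    by (rule cross_t_intersecting_wfam_le[OF _ _ _ assms(7-9) _ _ wts M1 M2, where l = l and l' = l'])
      (use assms(5,6) in auto)
  moreover have "wfam ?A \<F> = wfam \<omega>1 \<F>" "wfam ?B \<G> = wfam \<omega>2 \<G>"
    using assms(5,6) by (auto simp: wfam_def intro!: sum.cong)
  ultimately show ?thesis by simp
qed

end
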